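(* Let $\delta^\ell(n)=\ell(n)-\log_2 n$. Then: (1) If $\alpha$ is a value of $\delta^\ell$ and $S(\alpha):=\{m\ge 1: \delta^\ell(m)=\alpha\}$, then there is a unique positive integer $n$ such that $S(\alpha)$ is either of the form $\{n\cdot 2^k: 0\le k\le K\}$ for some finite $K\ge 0$, or of the form $\{n\cdot 2^k: k\ge 0\}$. (This $n$ is called the leader of $S(\alpha)$.) (2) The set $S(\alpha)$ is infinite if and only if $\alpha$ is the smallest value among all the defects $\delta^\ell(2^k n)$, $k\ge 0$, where $n$ is the leader of $S(\alpha)$. (3) For a fixed odd positive integer $n$, the sequence $(\delta^\ell(n\cdot 2^k))_{k\ge 0}$ is non-increasing, takes only finitely many values, all differing from each other by integers, and its smallest value $\alpha$ has the property that whenever $\delta^\ell(m)=\alpha$ and $k\ge 0$, we have $\ell(m\cdot 2^k)=\ell(m)+k$.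
   Context: An addition chain for a positive integer $n$ is a sequence $(a_0,a_1,\ldots,a_r)$ with $a_0=1$, $a_r=n$, and such that for every $1\le k\le r$ there exist $0\le i,j<k$ with $a_k=a_i+a_j$; $r$ is the length of the chain. $\ell(n)$ denotes the least length of an addition chain for $n$. *)

theory Defs
  imports Complex_Main
begin

text \<open>The list \<open>as\<close> of length \<open>r + 1\<close> is an addition chain of length \<open>r\<close> (number of steps) for \<open>n\<close>.\<close>

definition addition_chain :: "nat \<Rightarrow> nat \<Rightarrow> nat list \<Rightarrow> bool" where
  "addition_chain n r as \<longleftrightarrow>
     length as = r + 1 \<and> as ! 0 = 1 \<and> as ! r = n \<and>
     (\<forall>k. 1 \<le> k \<and> k \<le> r \<longrightarrow> (\<exists>i j. i < k \<and> j < k \<and> as ! k = as ! i + as ! j))"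

text \<open>Every \<open>n \<ge> 1\<close> has a chain \<open>1, 2, \<dots>, n\<close>, so the least element exists; the value at \<open>0\<close> is
  unspecified and never used.\<close>

definition chain_length :: "nat \<Rightarrow> nat" where
  "chain_length n = (LEAST r. \<exists>as. addition_chain n r as)"

definition defect :: "nat \<Rightarrow> real" where
  "defect n = real (chain_length n) - log 2 (real n)"

definition defect_class :: "real \<Rightarrow> nat set" where
  "defect_class \<alpha> = {m. m \<ge> 1 \<and> defect m = \<alpha>}"

definition is_leader :: "nat \<Rightarrow> nat set \<Rightarrow> bool" where
  "is_leader n A \<longleftrightarrow> n \<ge> 1 \<and>
     ((\<exists>K. A = {n * 2 ^ k | k. k \<le> K}) \<or> A = {n * 2 ^ k | k. True})"

definition is_smallest :: "real \<Rightarrow> real set \<Rightarrow> bool" where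
  "is_smallest x A \<longleftrightarrow> x \<in> A \<and> (\<forall>y\<in>A. x \<le> y)"

end

theory Submission
  imports Defs
begin

text \<open>Doubling the last entry extends a chain for \<open>n\<close> to one for \<open>2 n\<close>, so the defect does not increase
  under doubling. It is nonnegative because \<open>a\<^sub>k \<le> 2 ^ k\<close>, and along \<open>n, 2 n, 4 n, \<dots>\<close> it changes by
  integers only; hence it takes finitely many values there and is eventually constant. Conversely,
  if two numbers have the same defect, then their binary logarithms differ by an integer, so they
  differ by a power of 2. A defect class is therefore an interval in a single doubling orbit.\<close>

section \<open>Addition chains: existence, doubling and growth\<close>

lemma addition_chain_upt:
  assumes "n \<ge> 1"
  shows "addition_chain n (n - 1) [1..<Suc n]"
  unfolding addition_chain_def
proof (intro conjI allI impI)
  have nth: "[1..<Suc n] ! t = Suc t" if "t < n" for t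
    using that nth_upt[of 1 t "Suc n"] by (simp del: upt_Suc)
  fix k assume k: "1 \<le> k \<and> k \<le> n - 1"
  then have "[1..<Suc n] ! k = [1..<Suc n] ! (k - 1) + [1..<Suc n] ! 0"
    using assms nth[of k] nth[of "k - 1"] nth[of 0] by linarith
  moreover have "k - 1 < k" "0 < k" using k by auto
  ultimately show "\<exists>i j. i < k \<and> j < k \<and> [1..<Suc n] ! k = [1..<Suc n] ! i + [1..<Suc n] ! j"
    by blast
qed (use assms in \<open>simp_all del: upt_Suc\<close>)

lemma addition_chain_double:
  assumes "addition_chain n r as"
  shows "addition_chain (2 * n) (Suc r) (as @ [2 * n])"
  unfolding addition_chain_def
proof (intro conjI allI impI)
  have as: "length as = Suc r" "as ! 0 = 1" "as ! r = n"
    and step: "\<And>k. 1 \<le> k \<Longrightarrow> k \<le> r \<Longrightarrow> \<exists>i j. i < k \<and> j < k \<and> as ! k = as ! i + as ! j"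
    using assms by (auto simp: addition_chain_def)
  show "length (as @ [2 * n]) = Suc r + 1" "(as @ [2 * n]) ! 0 = 1" "(as @ [2 * n]) ! Suc r = 2 * n"
    using as by (simp_all add: nth_append)
  fix k assume k: "1 \<le> k \<and> k \<le> Suc r"
  show "\<exists>i j. i < k \<and> j < k \<and> (as @ [2 * n]) ! k = (as @ [2 * n]) ! i + (as @ [2 * n]) ! j"
  proof (cases "k = Suc r")
    case True
    \<comment> \<open>Both summands are the last entry of the old chain: the witness
      \<open>r\<close> serves for \<open>i\<close> and for \<open>j\<close>.\<close>
    then show ?thesis using as by (intro exI[of _ r]) (simp add: nth_append)
  next
    case False
    then obtain i j where ij: "i < k" "j < k" "as ! k = as ! i + as ! j"
      using k step[of k] by auto
    then show ?thesis
      using False k as by (intro exI[of _ i] exI[of _ j]) (simp add: nth_append)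
  qed
qed

text \<open>Both summands of an entry come strictly earlier, so each step at most doubles the bound.
  This is what makes the defect nonnegative.\<close>

lemma addition_chain_nth_le_power:
  assumes "addition_chain n r as" "k \<le> r"
  shows "as ! k \<le> 2 ^ k"
  using assms(2)
proof (induction k rule: less_induct)
  case (less k)
  show ?case
  proof (cases k)
    case 0
    then show ?thesis using assms(1) by (simp add: addition_chain_def)
  next
    case (Suc l)
    then obtain i j where ij: "i < k" "j < k" "as ! k = as ! i + as ! j"
      using assms(1) less.prems unfolding addition_chain_def by (metis le_add1 plus_1_eq_Suc)
    \<comment> \<open>Entries need not increase, so all earlier ones are bounded by the same power
      \<open>2 ^ l\<close>; two of them add up to at most \<open>2 ^ k\<close>.\<close>
    have bound: "as ! t \<le> 2 ^ l" if "t < k" for t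
    proof -
      have "as ! t \<le> 2 ^ t" using less.IH[OF that] that less.prems by simp
      also have "\<dots> \<le> 2 ^ l" using that Suc by (intro power_increasing) auto
      finally show ?thesis .
    qed
    show ?thesis using bound[OF ij(1)] bound[OF ij(2)] ij(3) Suc by simp
  qed
qed

lemma ex_addition_chain_chain_length:
  assumes "n \<ge> 1"
  shows "\<exists>as. addition_chain n (chain_length n) as"
  unfolding chain_length_def
  by (rule LeastI_ex) (use addition_chain_upt[OF assms] in blast)

lemma chain_length_le: "addition_chain n r as \<Longrightarrow> chain_length n \<le> r"
  unfolding chain_length_def by (rule Least_le) blast

lemma chain_length_double_le:
  assumes "n \<ge> 1"
  shows "chain_length (2 * n) \<le> Suc (chain_length n)"
  using ex_addition_chain_chain_length[OF assms] addition_chain_double chain_length_le by blast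

lemma le_power_chain_length:
  assumes "n \<ge> 1"
  shows "n \<le> 2 ^ chain_length n"
  using ex_addition_chain_chain_length[OF assms]
  by (metis addition_chain_def addition_chain_nth_le_power order_refl)

section \<open>Defects along a doubling orbit\<close>

lemma defect_nonneg:
  assumes "n \<ge> 1"
  shows "defect n \<ge> 0"
proof -
  have "real n \<le> 2 ^ chain_length n"
    using le_power_chain_length[OF assms] by (metis of_nat_le_iff of_nat_numeral of_nat_power)
  then have "log 2 (real n) \<le> real (chain_length n)"
    using assms by (simp add: log_le_iff powr_realpow)
  then show ?thesis by (simp add: defect_def)
qed

text \<open>The factor \<open>2 ^ k\<close> contributes exactly \<open>k\<close> to the logarithm.
  Up to the fixed real \<open>log 2 (real n)\<close> the defect is thus an integer, from which
  monotonicity and integer differences are read off.\<close>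

lemma defect_mult_power:
  assumes "n \<ge> 1"
  shows "defect (n * 2 ^ k) = real (chain_length (n * 2 ^ k)) - real k - log 2 (real n)"
  using assms by (simp add: defect_def log_mult log_nat_power)

lemma decseq_defect_mult_power:
  assumes "n \<ge> 1"
  shows "decseq (\<lambda>k. defect (n * 2 ^ k))"
proof (rule decseq_SucI)
  fix k
  have "chain_length (n * 2 ^ Suc k) \<le> Suc (chain_length (n * 2 ^ k))"
    using chain_length_double_le[of "n * 2 ^ k"] assms by (simp add: mult.left_commute)
  then show "defect (n * 2 ^ Suc k) \<le> defect (n * 2 ^ k)"
    unfolding defect_mult_power[OF assms] by linarith
qed

lemma defect_mult_power_diff_Ints:
  assumes "n \<ge> 1"
  shows "defect (n * 2 ^ i) - defect (n * 2 ^ j) \<in> \<int>"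
proof -
  have "defect (n * 2 ^ i) - defect (n * 2 ^ j) =
    of_int ((int (chain_length (n * 2 ^ i)) - int i) - (int (chain_length (n * 2 ^ j)) - int j))"
    unfolding defect_mult_power[OF assms] by simp
  then show ?thesis by (metis Ints_of_int)
qed

lemma finite_range_defect_mult_power:
  assumes "n \<ge> 1"
  shows "finite (range (\<lambda>k. defect (n * 2 ^ k)))"
proof (rule finite_subset)
  let ?c = "defect n"
  \<comment> \<open>The integer offset from \<open>defect n\<close> is at most 0 by monotonicity and
    at least \<open>- ?c\<close> by nonnegativity, which leaves finitely many integers.\<close>
  show "range (\<lambda>k. defect (n * 2 ^ k)) \<subseteq> (\<lambda>z. ?c + of_int z) ` {\<lceil>- ?c\<rceil>..0}"
  proof safe
    fix k
    obtain z where z: "defect (n * 2 ^ k) - ?c = of_int z"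
      using defect_mult_power_diff_Ints[OF assms, of k 0] by (auto elim: Ints_cases)
    have "defect (n * 2 ^ k) \<le> ?c"
      using decseqD[OF decseq_defect_mult_power[OF assms], of 0 k] by simp
    moreover have "defect (n * 2 ^ k) \<ge> 0" using assms by (simp add: defect_nonneg)
    ultimately have "z \<in> {\<lceil>- ?c\<rceil>..0}"
      using z by (simp add: ceiling_le_iff)
    moreover have "defect (n * 2 ^ k) = ?c + of_int z" using z by simp
    ultimately show "defect (n * 2 ^ k) \<in> (\<lambda>z. ?c + of_int z) ` {\<lceil>- ?c\<rceil>..0}" by blast
  qed
qed simp

section \<open>Numbers of equal defect\<close>

lemma defect_eq_imp_mult_power_eq:
  assumes "m \<ge> 1" "n \<ge> 1" "defect m = defect n"
  shows "m * 2 ^ chain_length n = n * 2 ^ chain_length m"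
proof -
  \<comment> \<open>Equal defects, with the logarithms collected so that no subtraction occurs; this
    form needs no comparison of \<open>m\<close> with \<open>n\<close>.\<close>
  have "log 2 (real m * 2 ^ chain_length n) = log 2 (real n * 2 ^ chain_length m)"
    using assms by (simp add: defect_def log_mult log_nat_power)
  then have "real m * 2 ^ chain_length n = real n * 2 ^ chain_length m"
    by (rule inj_onD[of "log 2" "{0<..}", rotated]) (use assms(1,2) in \<open>auto intro: log_inj\<close>)
  then have "real (m * 2 ^ chain_length n) = real (n * 2 ^ chain_length m)" by simp
  then show ?thesis by (simp only: of_nat_eq_iff)
qed

lemma defect_eq_imp_mult_power:
  assumes "m \<ge> 1" "n \<ge> 1" "defect m = defect n" "n \<le> m"
  obtains k where "m = n * 2 ^ k"
proof -
  let ?a = "chain_length n" and ?b = "chain_length m"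
  have eq: "m * 2 ^ ?a = n * 2 ^ ?b"
    using defect_eq_imp_mult_power_eq[OF assms(1-3)] .
  \<comment> \<open>With equal defects, the chain lengths are ordered as the logarithms are, so the
    difference \<open>?b - ?a\<close> is not truncated and \<open>2 ^ ?a\<close> can be
    cancelled.\<close>
  have "log 2 (real n) \<le> log 2 (real m)" using assms(2,4) by simp
  then have "?a \<le> ?b" using assms(3) unfolding defect_def by linarith
  then have "n * 2 ^ ?b = n * 2 ^ (?b - ?a) * 2 ^ ?a"
    by (simp add: power_add[symmetric])
  then have "m * 2 ^ ?a = n * 2 ^ (?b - ?a) * 2 ^ ?a" using eq by (simp only:)
  then have "m = n * 2 ^ (?b - ?a)" by (simp only: mult_cancel2) simp
  then show ?thesis by (rule that)
qed

section \<open>Leaders of defect classes\<close>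

lemma down_closed_nat_cases:
  fixes A :: "nat set"
  assumes "A \<noteq> {}" "\<And>i j. j \<in> A \<Longrightarrow> i \<le> j \<Longrightarrow> i \<in> A"
  shows "A = UNIV \<or> (\<exists>K. A = {..K})"
proof (cases "finite A")
  case True
  then have "A = {..Max A}" using assms by (auto intro: assms(2)[OF Max_in])
  then show ?thesis by blast
next
  case False
  then have "\<exists>j\<in>A. i \<le> j" for i
    unfolding finite_nat_set_iff_bounded_le by (meson nat_le_linear)
  then have "A = UNIV" using assms(2) by blast
  then show ?thesis by blast
qed

text \<open>In both shapes the exponent 0 gives the minimum of the set. Uniqueness of the leader
  follows.\<close>

lemma is_leader_least:
  assumes "is_leader n A"
  shows "n \<in> A" "a \<in> A \<Longrightarrow> n \<le> a"
proof -
  have "n = n * 2 ^ 0" by simp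
  then show "n \<in> A" using assms unfolding is_leader_def by blast
  show "a \<in> A \<Longrightarrow> n \<le> a" using assms unfolding is_leader_def by auto
qed

lemma is_leader_unique:
  assumes "is_leader m A" "is_leader n A"
  shows "m = n"
  using is_leader_least[OF assms(1)] is_leader_least[OF assms(2)] by (meson antisym)

lemma ex_leader_defect_class:
  assumes "\<alpha> \<in> defect ` {1..}"
  shows "\<exists>n. is_leader n (defect_class \<alpha>)"
proof -
  let ?S = "defect_class \<alpha>"
  define n where "n = (LEAST m. m \<in> ?S)"
  have "\<exists>m. m \<in> ?S" using assms by (auto simp: defect_class_def)
  then have n: "n \<in> ?S" unfolding n_def by (rule LeastI_ex)
  then have n1: "n \<ge> 1" "defect n = \<alpha>" by (auto simp: defect_class_def)
  \<comment> \<open>Once this set of exponents is known to be downward closed, it is all of the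
    naturals or an initial segment: the two shapes in \<open>is_leader\<close>.\<close>
  define A where "A = {k. n * 2 ^ k \<in> ?S}"
  have S: "?S = {n * 2 ^ k | k. k \<in> A}"
  proof (intro subset_antisym subsetI)
    fix m assume m: "m \<in> ?S"
    then have "n \<le> m" unfolding n_def by (rule Least_le)
    moreover have "m \<ge> 1" "defect m = defect n" using m n1 by (auto simp: defect_class_def)
    ultimately obtain k where "m = n * 2 ^ k" using defect_eq_imp_mult_power n1(1) by blast
    then show "m \<in> {n * 2 ^ k | k. k \<in> A}" using m by (auto simp: A_def)
  qed (auto simp: A_def)
  have "0 \<in> A" using n by (simp add: A_def)
  moreover have "i \<in> A" if "j \<in> A" "i \<le> j" for i j
  proof -
    \<comment> \<open>The defect at exponent \<open>i\<close> is squeezed between those at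
      \<open>j\<close> and at 0, and both equal \<alpha>.\<close>
    note dec = decseqD[OF decseq_defect_mult_power[OF n1(1)]]
    have "defect (n * 2 ^ i) = \<alpha>"
      using dec[OF that(2)] dec[of 0 i] that(1) n1 by (simp add: A_def defect_class_def)
    then show ?thesis using n1 by (simp add: A_def defect_class_def)
  qed
  ultimately have "A = UNIV \<or> (\<exists>K. A = {..K})" using down_closed_nat_cases[of A] by blast
  then show ?thesis using S n1(1) unfolding is_leader_def by (intro exI[of _ n]) auto
qed

section \<open>Infinite classes and smallest defects\<close>

lemma infinite_mult_power:
  assumes "n \<ge> (1::nat)"
  shows "infinite {n * 2 ^ k | k. True}"
proof -
  have "inj (\<lambda>k. n * 2 ^ k)" using assms by (auto intro: injI)
  then have "infinite (range (\<lambda>k. n * 2 ^ k))" using finite_imageD by blast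
  then show ?thesis by (simp add: full_SetCompr_eq)
qed

lemma infinite_defect_class_iff:
  assumes "is_leader n (defect_class \<alpha>)"
  shows "infinite (defect_class \<alpha>) \<longleftrightarrow> is_smallest \<alpha> (range (\<lambda>k. defect (2 ^ k * n)))"
proof
  let ?S = "defect_class \<alpha>"
  assume inf: "infinite ?S"
  have "?S = {n * 2 ^ k | k. True}"
    using assms inf unfolding is_leader_def by auto
  then have "defect (2 ^ k * n) = \<alpha>" for k
    by (auto simp: defect_class_def mult.commute)
  then show "is_smallest \<alpha> (range (\<lambda>k. defect (2 ^ k * n)))" by (simp add: is_smallest_def)
next
  let ?S = "defect_class \<alpha>"
  assume "is_smallest \<alpha> (range (\<lambda>k. defect (2 ^ k * n)))"
  then have ge: "\<alpha> \<le> defect (n * 2 ^ k)" for k by (auto simp: is_smallest_def mult.commute)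
  have n: "n \<ge> 1" "n \<in> ?S" using assms is_leader_least(1) by (auto simp: is_leader_def)
  \<comment> \<open>The sequence starts at \<alpha> because \<open>n\<close> lies in the class; it
    cannot increase, and by minimality it never drops below \<alpha>.\<close>
  have "n * 2 ^ k \<in> ?S" for k
    using ge[of k] decseqD[OF decseq_defect_mult_power[OF n(1)], of 0 k] n
    by (simp add: defect_class_def)
  then have "{n * 2 ^ k | k. True} \<subseteq> ?S" by blast
  then show "infinite ?S" using infinite_mult_power[OF n(1)] finite_subset by blast
qed

text \<open>The doubling orbit of \<open>m\<close> eventually merges with that of \<open>n\<close>,
  so the minimum over the latter also bounds the defects of the former from below.\<close>

lemma chain_length_mult_power_of_smallest:
  assumes "n \<ge> 1" "is_smallest \<alpha> (range (\<lambda>k. defect (n * 2 ^ k)))" "m \<ge> 1" "defect m = \<alpha>"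
  shows "chain_length (m * 2 ^ k) = chain_length m + k"
proof -
  obtain j where j: "defect (n * 2 ^ j) = \<alpha>" using assms(2) by (auto simp: is_smallest_def)
  obtain a b where "m * 2 ^ a = n * 2 ^ j * 2 ^ b"
    using defect_eq_imp_mult_power_eq[of m "n * 2 ^ j"] assms j by auto
  \<comment> \<open>Doubling the common value \<open>k\<close> more times gives a point of the orbit
    of \<open>n\<close> that lies beyond \<open>m * 2 ^ k\<close>. Its defect is at least \<alpha>,
    so the defect of \<open>m * 2 ^ k\<close> is squeezed to \<alpha>.\<close>
  then have "m * 2 ^ (k + a) = n * 2 ^ (j + b + k)"
    by (metis ab_semigroup_mult_class.mult_ac(1) add.commute power_add)
  then have "\<alpha> \<le> defect (m * 2 ^ (k + a))"
    using assms(2) by (simp add: is_smallest_def)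
  moreover note decseqD[OF decseq_defect_mult_power[OF assms(3)], of k "k + a"]
    decseqD[OF decseq_defect_mult_power[OF assms(3)], of 0 k]
  ultimately have "defect (m * 2 ^ k) = defect m" using assms(4) by simp
  then show ?thesis unfolding defect_mult_power[OF assms(3)] by (simp add: defect_def)
qed

theorem theorem1p5:
  "(\<forall>\<alpha> \<in> defect ` {1..}. \<exists>!n. is_leader n (defect_class \<alpha>)) \<and>
   (\<forall>\<alpha> \<in> defect ` {1..}. \<forall>n. is_leader n (defect_class \<alpha>) \<longrightarrow>
      (infinite (defect_class \<alpha>) \<longleftrightarrow> is_smallest \<alpha> (range (\<lambda>k. defect (2 ^ k * n))))) \<and>
   (\<forall>n::nat. odd n \<longrightarrow>
      decseq (\<lambda>k. defect (n * 2 ^ k)) \<and>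
      finite (range (\<lambda>k. defect (n * 2 ^ k))) \<and>
      (\<forall>i j. defect (n * 2 ^ i) - defect (n * 2 ^ j) \<in> \<int>) \<and>
      (\<exists>\<alpha>. is_smallest \<alpha> (range (\<lambda>k. defect (n * 2 ^ k))) \<and>
           (\<forall>m \<ge> 1. defect m = \<alpha> \<longrightarrow>
              (\<forall>k. chain_length (m * 2 ^ k) = chain_length m + k))))"
proof (intro conjI ballI allI impI)
  fix \<alpha> assume "\<alpha> \<in> defect ` {1..}"
  then show "\<exists>!n. is_leader n (defect_class \<alpha>)"
    using ex_leader_defect_class is_leader_unique by blast
next
  fix n \<alpha> assume "is_leader n (defect_class \<alpha>)"
  then show "infinite (defect_class \<alpha>) \<longleftrightarrow> is_smallest \<alpha> (range (\<lambda>k. defect (2 ^ k * n)))"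
    by (rule infinite_defect_class_iff)
next
  fix n :: nat assume "odd n"
  then have n: "n \<ge> 1" by (cases n) auto
  let ?R = "range (\<lambda>k. defect (n * 2 ^ k))"
  show "decseq (\<lambda>k. defect (n * 2 ^ k))" using n by (rule decseq_defect_mult_power)
  show fin: "finite ?R" using n by (rule finite_range_defect_mult_power)
  show "defect (n * 2 ^ i) - defect (n * 2 ^ j) \<in> \<int>" for i j
    using n by (rule defect_mult_power_diff_Ints)
  have "is_smallest (Min ?R) ?R" using fin by (auto simp: is_smallest_def intro: Min_in)
  then show "\<exists>\<alpha>. is_smallest \<alpha> ?R \<and>
      (\<forall>m \<ge> 1. defect m = \<alpha> \<longrightarrow> (\<forall>k. chain_length (m * 2 ^ k) = chain_length m + k))"
    using chain_length_mult_power_of_smallest[OF n] by blast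
qed

end
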